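(* Let $(X,T)$ be a transitive system. Then $\mathbb{L}_{m,d}=\overline{\mathbb{L}}_{m,d}$.
   Context: A dynamical system $(X,T)$ consists of a nonempty compact metric space $X$ (metric $d$) and a continuous surjective map $T:X\to X$; by standing assumption $X$ has no isolated points and is not a singleton. "Opene" means open and nonempty. The system is transitive if for all opene $U,V\subset X$ there is $n\ge0$ with $U\cap T^{-n}V\neq\varnothing$. $\mathbb{L}_{m,d}$ is the supremum of all $\delta>0$ such that for any finite collection $U_1,\dots,U_k$ of opene subsets of $X$ there exist $x_i,y_i\in U_i$ and a nonnegative integer $n$ with $\min_{1\le i\le k}d(T^nx_i,T^ny_i)>\delta$. $\overline{\mathbb{L}}_{m,d}$ is the supremum of all $\delta>0$ such that for any finite collection $U_1,\dots,U_k$ of opene subsets of $X$ there exist $x_i,y_i\in U_i$ with $\limsup_{n\to\infty}\min_{1\le i\le k}d(T^nx_i,T^ny_i)>\delta$. By convention $\sup\varnothing=0$. *)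

theory Defs
  imports "HOL-Analysis.Analysis"
begin

text \<open>The space is a subset \<open>X\<close> of a metric type, with the induced metric \<open>dist\<close>; the values
  of \<open>T\<close> outside \<open>X\<close> are irrelevant.\<close>

definition dynamical_system :: "'a::metric_space set \<Rightarrow> ('a \<Rightarrow> 'a) \<Rightarrow> bool" where
  "dynamical_system X T \<longleftrightarrow>
     X \<noteq> {} \<and> compact X \<and> continuous_on X T \<and> T ` X = X \<and>
     (\<forall>x\<in>X. x islimpt X) \<and> (\<nexists>a. X = {a})"

definition opene :: "'a::topological_space set \<Rightarrow> 'a set \<Rightarrow> bool" where
  "opene X U \<longleftrightarrow> openin (top_of_set X) U \<and> U \<noteq> {}"

definition transitive_system :: "'a::metric_space set \<Rightarrow> ('a \<Rightarrow> 'a) \<Rightarrow> bool" where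
  "transitive_system X T \<longleftrightarrow> dynamical_system X T \<and>
     (\<forall>U V. opene X U \<longrightarrow> opene X V \<longrightarrow> (\<exists>n. U \<inter> ((T ^^ n) -` V \<inter> X) \<noteq> {}))"

definition min_dist :: "('a::metric_space \<Rightarrow> 'a) \<Rightarrow> nat \<Rightarrow> (nat \<Rightarrow> 'a) \<Rightarrow> (nat \<Rightarrow> 'a) \<Rightarrow> nat \<Rightarrow> real" where
  "min_dist T k x y n = (MIN i\<in>{1..k}. dist ((T ^^ n) (x i)) ((T ^^ n) (y i)))"

text \<open>\<open>Sup {}\<close> is not determined on type \<^typ>\<open>real\<close>, hence the explicit convention.\<close>

definition sup0 :: "real set \<Rightarrow> real" where
  "sup0 S = (if S = {} then 0 else Sup S)"

definition L_m :: "'a::metric_space set \<Rightarrow> ('a \<Rightarrow> 'a) \<Rightarrow> real" where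
  "L_m X T = sup0 {\<delta>. \<delta> > 0 \<and>
     (\<forall>k\<ge>1. \<forall>U :: nat \<Rightarrow> 'a set. (\<forall>i\<in>{1..k}. opene X (U i)) \<longrightarrow>
        (\<exists>x y. (\<forall>i\<in>{1..k}. x i \<in> U i \<and> y i \<in> U i) \<and>
               (\<exists>n. min_dist T k x y n > \<delta>)))}"

text \<open>The limsup is taken in \<^typ>\<open>ereal\<close>, where it always exists.\<close>

definition L_m_limsup :: "'a::metric_space set \<Rightarrow> ('a \<Rightarrow> 'a) \<Rightarrow> real" where
  "L_m_limsup X T = sup0 {\<delta>. \<delta> > 0 \<and>
     (\<forall>k\<ge>1. \<forall>U :: nat \<Rightarrow> 'a set. (\<forall>i\<in>{1..k}. opene X (U i)) \<longrightarrow>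
        (\<exists>x y. (\<forall>i\<in>{1..k}. x i \<in> U i \<and> y i \<in> U i) \<and>
               limsup (\<lambda>n. ereal (min_dist T k x y n)) > ereal \<delta>))}"

end

theory Submission
  imports Defs
begin

text \<open>
  The two suprema agree because they are taken over the same set of \<open>\<delta>\<close>. A number whose limsup
  exceeds \<open>\<delta>\<close> exceeds \<open>\<delta>\<close> at some time, so only one inclusion has content: points \<open>x\<^sub>i, y\<^sub>i \<in> U\<^sub>i\<close>
  that are more than \<open>\<delta>\<close> apart for all \<open>i\<close> at one time \<open>n\<close> must be replaced by points of the same
  \<open>U\<^sub>i\<close> that are uniformly more than \<open>\<delta>\<close> apart at infinitely many times.

  Separating a given pair again later by means of the hypothesis would lose a factor 2 to the
  triangle inequality. Recurrence loses nothing. A transitive system without isolated points has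
  a point \<open>z\<close> whose orbit enters every opene set infinitely often
  (\<open>transitive_system_recurrent_point\<close>). By continuity of \<open>T\<^sup>n\<close>, the points \<open>x\<^sub>i\<close> and \<open>y\<^sub>i\<close> may be
  moved slightly onto the orbit of this single point, say to \<open>T\<^bsup>a i\<^esup> z\<close> and \<open>T\<^bsup>b i\<^esup> z\<close>. All the
  distances at time \<open>n\<close> are now continuous functions of \<open>z\<close>, so they stay large when \<open>z\<close> is
  replaced by a nearby \<open>T\<^sup>m z\<close>. Because the maps \<open>T\<^sup>j\<close> commute, this replacement amounts to passing from
  time \<open>n\<close> to time \<open>n + m\<close>, and \<open>z\<close> returns close to itself for infinitely many \<open>m\<close>.
\<close>

section \<open>Iterates of a self-map\<close>

lemma funpow_mem:
  assumes "T ` X \<subseteq> X" "x \<in> X"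
  shows "(T ^^ n) x \<in> X"
  using assms by (induction n) (simp_all add: image_subset_iff)

lemma continuous_on_funpow:
  assumes "continuous_on X T" "T ` X \<subseteq> X"
  shows "continuous_on X (T ^^ n)"
proof (induction n)
  case 0
  then show ?case by (simp add: id_def)
next
  case (Suc n)
  have "(T ^^ n) ` X \<subseteq> X"
    using funpow_mem[OF assms(2)] by blast
  then have "continuous_on X (T \<circ> (T ^^ n))"
    using Suc assms(1) by (intro continuous_on_compose) (auto intro: continuous_on_subset)
  then show ?case by simp
qed

section \<open>Recurrent points with dense orbit\<close>

text \<open>The sets \<open>X \<inter> ball c (1/n)\<close>, with \<open>c\<close> running through a finite \<open>1/n\<close>-net for each \<open>n\<close>, form
  a countable base.\<close>

lemma compact_countable_opene_base:
  fixes X :: "'a::metric_space set"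
  assumes "compact X"
  obtains \<B> where "countable \<B>" "\<And>B. B \<in> \<B> \<Longrightarrow> opene X B"
    "\<And>U. opene X U \<Longrightarrow> \<exists>B\<in>\<B>. B \<subseteq> U"
proof -
  have "\<exists>C. finite C \<and> C \<subseteq> X \<and> X \<subseteq> (\<Union>c\<in>C. ball c (1 / real (Suc n)))" for n
    using seq_compact_imp_totally_bounded[OF compact_imp_seq_compact[OF assms]] by simp
  then obtain C where C: "\<And>n. finite (C n)" "\<And>n. C n \<subseteq> X"
      "\<And>n. X \<subseteq> (\<Union>c\<in>C n. ball c (1 / real (Suc n)))"
    by metis
  define \<B> where "\<B> = (\<Union>n. (\<lambda>c. X \<inter> ball c (1 / real (Suc n))) ` C n)"
  show thesis
  proof
    show "countable \<B>"
      unfolding \<B>_def using C(1) by (auto intro: countable_finite)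
    show "opene X B" if B: "B \<in> \<B>" for B
    proof -
      obtain n c where "c \<in> C n" "B = X \<inter> ball c (1 / real (Suc n))"
        using B by (auto simp: \<B>_def)
      moreover from this have "c \<in> B"
        using C(2) by auto
      ultimately show ?thesis
        by (auto simp: opene_def intro: openin_open_Int)
    qed
    show "\<exists>B\<in>\<B>. B \<subseteq> U" if U: "opene X U" for U
    proof -
      obtain x where x: "x \<in> U" "x \<in> X"
        using U openin_imp_subset unfolding opene_def by blast
      obtain e where e: "e > 0" "ball x e \<inter> X \<subseteq> U"
        using U x unfolding opene_def openin_contains_ball by blast
      obtain n where n: "1 / real (Suc n) < e / 2"
        using nat_approx_posE[of "e / 2"] e(1) by auto
      obtain c where c: "c \<in> C n" "dist c x < 1 / real (Suc n)"
        using C(3)[of n] x(2) by auto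
      have "ball c (1 / real (Suc n)) \<subseteq> ball x e"
      proof
        fix w assume "w \<in> ball c (1 / real (Suc n))"
        then show "w \<in> ball x e"
          using c(2) n dist_triangle[of x w c] by (simp add: dist_commute)
      qed
      then have "X \<inter> ball c (1 / real (Suc n)) \<subseteq> U"
        using e(2) by blast
      then show ?thesis
        using c(1) unfolding \<B>_def by blast
    qed
  qed
qed

text \<open>By transitivity the points whose orbit meets a given opene set form a dense open set, so the
  Baire category theorem applies to a countable base.\<close>

lemma transitive_system_dense_orbit:
  fixes X :: "'a::metric_space set"
  assumes "transitive_system X T"
  obtains z where "z \<in> X" "\<And>U. opene X U \<Longrightarrow> \<exists>m. (T ^^ m) z \<in> U"
proof -
  have X: "X \<noteq> {}" "compact X" "continuous_on X T" "T ` X \<subseteq> X"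
    and trans: "\<And>U V. opene X U \<Longrightarrow> opene X V \<Longrightarrow> \<exists>n. U \<inter> ((T ^^ n) -` V \<inter> X) \<noteq> {}"
    using assms unfolding transitive_system_def dynamical_system_def by blast+
  obtain \<B> where \<B>: "countable \<B>" "\<And>B. B \<in> \<B> \<Longrightarrow> opene X B"
      "\<And>U. opene X U \<Longrightarrow> \<exists>B\<in>\<B>. B \<subseteq> U"
    using compact_countable_opene_base[OF X(2)] by metis
  define G where "G = (\<lambda>B. \<Union>m. X \<inter> (T ^^ m) -` B)"
  have "top_of_set X closure_of \<Inter>(G ` \<B>) = topspace (top_of_set X)"
  proof (rule Baire_category)
    have "compact_space (top_of_set X)"
      using X(2) by (simp add: compact_space_subtopology)
    moreover have "regular_space (top_of_set X)"
      by (intro metrizable_imp_regular_space metrizable_space_subtopology metrizable_space_euclidean)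
    ultimately show "completely_metrizable_space (top_of_set X) \<or>
        locally_compact_space (top_of_set X) \<and> regular_space (top_of_set X)"
      using compact_imp_locally_compact_space by blast
    show "countable (G ` \<B>)"
      using \<B>(1) by simp
    show "openin (top_of_set X) S \<and> top_of_set X closure_of S = topspace (top_of_set X)"
      if S: "S \<in> G ` \<B>" for S
    proof
      obtain B where B: "opene X B" "S = G B"
        using S \<B>(2) by blast
      show "openin (top_of_set X) S"
        unfolding B(2) G_def
      proof (rule openin_Union, erule imageE, simp only:)
        fix m
        have "(T ^^ m) \<in> X \<rightarrow> X"
          using funpow_mem[OF X(4)] by (rule Pi_I)
        then show "openin (top_of_set X) (X \<inter> (T ^^ m) -` B)"
          using B(1) unfolding opene_def
          by (intro continuous_openin_preimage[OF continuous_on_funpow[OF X(3,4)]]) auto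
      qed
      show "top_of_set X closure_of S = topspace (top_of_set X)"
        unfolding dense_intersects_open
      proof (intro allI impI)
        fix V assume "openin (top_of_set X) V \<and> V \<noteq> {}"
        then have "opene X V"
          by (simp add: opene_def)
        then obtain n where "V \<inter> ((T ^^ n) -` B \<inter> X) \<noteq> {}"
          using trans[OF _ B(1)] by blast
        then show "S \<inter> V \<noteq> {}"
          unfolding B(2) G_def by blast
      qed
    qed
  qed
  then have "\<Inter>(G ` \<B>) \<inter> X \<noteq> {}"
    using X(1) unfolding dense_intersects_open by (metis openin_topspace topspace_euclidean_subtopology)
  then obtain z where z: "z \<in> X" "\<And>B. B \<in> \<B> \<Longrightarrow> z \<in> G B"
    by blast
  show thesis
  proof
    show "\<exists>m. (T ^^ m) z \<in> U" if "opene X U" for U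
      using \<B>(3)[OF that] z(2) unfolding G_def by blast
  qed (fact z(1))
qed

lemma opene_Diff_finite:
  fixes X :: "'a::metric_space set"
  assumes "\<And>x. x \<in> X \<Longrightarrow> x islimpt X" "opene X U" "finite F"
  shows "opene X (U - F)"
proof -
  obtain S where S: "open S" "U = X \<inter> S"
    using assms(2) unfolding opene_def openin_open by blast
  obtain x where x: "x \<in> X" "x \<in> S"
    using assms(2) S(2) unfolding opene_def by blast
  have "x islimpt X \<inter> S"
    using assms(1)[OF x(1)] S(1) x(2) by (intro islimpt_Int_eventually eventually_at_in_open')
  then have "infinite U"
    using S(2) islimpt_finite by blast
  then have "U - F \<noteq> {}"
    using assms(3) by (metis Diff_eq_empty_iff finite_subset)
  moreover have "U - F = X \<inter> (S - F)"
    using S(2) by blast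
  moreover have "open (S - F)"
    using S(1) assms(3) by (simp add: open_Diff finite_imp_closed)
  ultimately show ?thesis
    unfolding opene_def openin_open by blast
qed

text \<open>With no isolated points, an opene set stays opene when an initial segment of a dense orbit is
  removed from it, and so the orbit enters it arbitrarily late.\<close>

lemma transitive_system_recurrent_point:
  fixes X :: "'a::metric_space set"
  assumes "transitive_system X T"
  obtains z where "z \<in> X" "\<And>U N. opene X U \<Longrightarrow> \<exists>m\<ge>N. (T ^^ m) z \<in> U"
proof -
  obtain z where z: "z \<in> X" "\<And>U. opene X U \<Longrightarrow> \<exists>m. (T ^^ m) z \<in> U"
    using transitive_system_dense_orbit[OF assms] by metis
  have limpt: "\<And>x. x \<in> X \<Longrightarrow> x islimpt X"
    using assms unfolding transitive_system_def dynamical_system_def by blast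
  show thesis
  proof
    fix U N assume "opene X U"
    then have "opene X (U - (\<lambda>m. (T ^^ m) z) ` {..<N})"
      using opene_Diff_finite[OF limpt] by blast
    then obtain m where m: "(T ^^ m) z \<in> U - (\<lambda>m. (T ^^ m) z) ` {..<N}"
      using z(2) by blast
    then have "m \<ge> N"
      by (meson DiffD2 imageI lessThan_iff not_le_imp_less)
    with m show "\<exists>m\<ge>N. (T ^^ m) z \<in> U"
      by blast
  qed (fact z(1))
qed

section \<open>From one separation time to infinitely many\<close>

lemma min_dist_gr_iff:
  assumes "k \<ge> 1"
  shows "min_dist T k x y n > c \<longleftrightarrow> (\<forall>i\<in>{1..k}. dist ((T ^^ n) (x i)) ((T ^^ n) (y i)) > c)"
  unfolding min_dist_def using assms by (subst Min_gr_iff) auto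

text \<open>Being separated at time \<open>n\<close> is an open condition on a pair, and a dense orbit meets any two
  opene sets.\<close>

lemma separated_pair_on_orbit:
  fixes X :: "'a::metric_space set"
  assumes "continuous_on X T" "T ` X \<subseteq> X"
    and orbit: "\<And>V. opene X V \<Longrightarrow> \<exists>m. (T ^^ m) z \<in> V"
    and U: "opene X U" "x \<in> U" "y \<in> U" "dist ((T ^^ n) x) ((T ^^ n) y) > c"
  obtains a b where "(T ^^ a) z \<in> U" "(T ^^ b) z \<in> U"
    "dist ((T ^^ n) ((T ^^ a) z)) ((T ^^ n) ((T ^^ b) z)) > c"
proof -
  define e where "e = (dist ((T ^^ n) x) ((T ^^ n) y) - c) / 2"
  have e: "e > 0"
    using U(4) by (simp add: e_def)
  have near: "\<exists>a. (T ^^ a) z \<in> U \<and> dist ((T ^^ n) w) ((T ^^ n) ((T ^^ a) z)) < e"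
    if w: "w \<in> U" for w
  proof -
    have UX: "U \<subseteq> X"
      using U(1) openin_imp_subset unfolding opene_def by blast
    let ?V = "U \<inter> (X \<inter> (T ^^ n) -` ball ((T ^^ n) w) e)"
    have "openin (top_of_set X) ?V"
      using U(1) continuous_openin_preimage_gen[OF continuous_on_funpow[OF assms(1,2)] open_ball]
      unfolding opene_def by blast
    moreover have "w \<in> ?V"
      using w UX e by auto
    ultimately have "opene X ?V"
      unfolding opene_def by blast
    then show ?thesis
      using orbit by fastforce
  qed
  obtain a where a: "(T ^^ a) z \<in> U" "dist ((T ^^ n) x) ((T ^^ n) ((T ^^ a) z)) < e"
    using near[OF U(2)] by blast
  obtain b where b: "(T ^^ b) z \<in> U" "dist ((T ^^ n) y) ((T ^^ n) ((T ^^ b) z)) < e"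
    using near[OF U(3)] by blast
  have "dist ((T ^^ n) ((T ^^ a) z)) ((T ^^ n) ((T ^^ b) z)) > c"
    using a(2) b(2) dist_triangle[of "(T ^^ n) x" "(T ^^ n) y" "(T ^^ n) ((T ^^ a) z)"]
      dist_triangle[of "(T ^^ n) ((T ^^ a) z)" "(T ^^ n) y" "(T ^^ n) ((T ^^ b) z)"]
    unfolding e_def by (simp add: dist_commute)
  with a(1) b(1) show thesis
    using that by blast
qed

text \<open>Near \<open>z\<close>, all the maps \<open>w \<mapsto> dist (T\<^bsup>n + a i\<^esup> w) (T\<^bsup>n + b i\<^esup> w)\<close> exceed \<open>c\<close>; a return of \<open>z\<close>
  to that neighbourhood at time \<open>m\<close> is a separation at time \<open>n + m\<close>.\<close>

lemma frequently_min_dist_orbit: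
  fixes X :: "'a::metric_space set"
  assumes "continuous_on X T" "T ` X \<subseteq> X" "z \<in> X"
    and orbit: "\<And>V N. opene X V \<Longrightarrow> \<exists>m\<ge>N. (T ^^ m) z \<in> V"
    and k: "k \<ge> 1"
    and sep: "min_dist T k (\<lambda>i. (T ^^ a i) z) (\<lambda>i. (T ^^ b i) z) n > c"
  shows "\<exists>\<^sub>F j in sequentially. min_dist T k (\<lambda>i. (T ^^ a i) z) (\<lambda>i. (T ^^ b i) z) j > c"
proof -
  define D where "D = (\<lambda>i w. dist ((T ^^ (n + a i)) w) ((T ^^ (n + b i)) w))"
  define V where "V = X \<inter> (\<Inter>i\<in>{1..k}. X \<inter> D i -` {c<..})"
  have "openin (top_of_set X) V"
    unfolding V_def
  proof (intro openin_Int_Inter)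
    fix S assume "S \<in> (\<lambda>i. X \<inter> D i -` {c<..}) ` {1..k}"
    then obtain i where "S = X \<inter> D i -` {c<..}"
      by blast
    moreover have "continuous_on X (D i)"
      unfolding D_def using continuous_on_funpow[OF assms(1,2)] by (intro continuous_on_dist)
    ultimately show "openin (top_of_set X) S"
      by (simp add: continuous_openin_preimage_gen)
  qed auto
  moreover have "z \<in> V"
    using sep assms(3) unfolding min_dist_gr_iff[OF k] V_def D_def by (simp add: funpow_add)
  ultimately have V: "opene X V"
    unfolding opene_def by blast
  have "\<exists>j\<ge>N. min_dist T k (\<lambda>i. (T ^^ a i) z) (\<lambda>i. (T ^^ b i) z) j > c" for N
  proof -
    obtain m where m: "m \<ge> N" "(T ^^ m) z \<in> V"
      using orbit[OF V] by blast
    have shift: "(T ^^ (n + q)) ((T ^^ m) z) = (T ^^ (n + m)) ((T ^^ q) z)" for q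
      by (metis add.assoc add.commute comp_apply funpow_add)
    have "min_dist T k (\<lambda>i. (T ^^ a i) z) (\<lambda>i. (T ^^ b i) z) (n + m) > c"
      using m(2) unfolding min_dist_gr_iff[OF k] V_def D_def by (auto simp: shift)
    with m(1) show ?thesis
      by (meson trans_le_add2)
  qed
  then show ?thesis
    unfolding frequently_sequentially by blast
qed

lemma transitive_system_limsup_separation:
  fixes X :: "'a::metric_space set"
  assumes "transitive_system X T" and k: "k \<ge> 1"
    and U: "\<forall>i\<in>{1..k}. opene X (U i)"
    and xy: "\<forall>i\<in>{1..k}. x i \<in> U i \<and> y i \<in> U i"
    and sep: "min_dist T k x y n > \<delta>"
  shows "\<exists>x y. (\<forall>i\<in>{1..k}. x i \<in> U i \<and> y i \<in> U i) \<and>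
           limsup (\<lambda>n. ereal (min_dist T k x y n)) > ereal \<delta>"
proof -
  have T: "continuous_on X T" "T ` X \<subseteq> X"
    using assms(1) unfolding transitive_system_def dynamical_system_def by blast+
  obtain z where z: "z \<in> X" "\<And>V N. opene X V \<Longrightarrow> \<exists>m\<ge>N. (T ^^ m) z \<in> V"
    using transitive_system_recurrent_point[OF assms(1)] by metis
  \<comment> \<open>The limsup inherits only the weak inequality \<open>\<ge> c\<close> from infinitely many values above \<open>c\<close>,
    hence the room between \<open>\<delta>\<close> and \<open>c\<close>.\<close>
  obtain c where c: "\<delta> < c" "c < min_dist T k x y n"
    using dense[OF sep] by blast
  have "\<exists>a b. (T ^^ a) z \<in> U i \<and> (T ^^ b) z \<in> U i \<and>
      dist ((T ^^ n) ((T ^^ a) z)) ((T ^^ n) ((T ^^ b) z)) > c" if i: "i \<in> {1..k}" for i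
  proof -
    have "dist ((T ^^ n) (x i)) ((T ^^ n) (y i)) > c"
      using c(2) i unfolding min_dist_gr_iff[OF k] by blast
    then show ?thesis
      using separated_pair_on_orbit[OF T, of z "U i" "x i" "y i" c n] z(2) U xy i by metis
  qed
  then obtain a b where ab: "\<And>i. i \<in> {1..k} \<Longrightarrow> (T ^^ a i) z \<in> U i \<and> (T ^^ b i) z \<in> U i \<and>
      dist ((T ^^ n) ((T ^^ a i) z)) ((T ^^ n) ((T ^^ b i) z)) > c"
    by metis
  let ?d = "min_dist T k (\<lambda>i. (T ^^ a i) z) (\<lambda>i. (T ^^ b i) z)"
  have "?d n > c"
    unfolding min_dist_gr_iff[OF k] using ab by blast
  then have freq: "\<exists>\<^sub>F j in sequentially. ?d j > c"
    using frequently_min_dist_orbit[OF T z(1) _ k] z(2) by blast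
  have "limsup (\<lambda>j. ereal (?d j)) \<ge> ereal c"
  proof (rule ccontr)
    assume "\<not> limsup (\<lambda>j. ereal (?d j)) \<ge> ereal c"
    then have "\<forall>\<^sub>F j in sequentially. ereal (?d j) < ereal c"
      by (intro Limsup_lessD) simp
    then have "\<forall>\<^sub>F j in sequentially. \<not> ?d j > c"
      by eventually_elim simp
    with freq show False
      unfolding frequently_def by blast
  qed
  then have "limsup (\<lambda>j. ereal (?d j)) > ereal \<delta>"
    using c(1) by (meson ereal_less_eq(3) less_ereal.simps(1) less_le_trans)
  with ab show ?thesis
    by (intro exI[of _ "\<lambda>i. (T ^^ a i) z"] exI[of _ "\<lambda>i. (T ^^ b i) z"]) blast
qed

lemma limsup_gr_imp_ex_gr:
  assumes "limsup (\<lambda>n. ereal (f n)) > ereal \<delta>"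
  shows "\<exists>n. f n > \<delta>"
proof (rule ccontr)
  assume "\<not> ?thesis"
  then have "limsup (\<lambda>n. ereal (f n)) \<le> ereal \<delta>"
    by (intro Limsup_bounded) (auto simp: not_less)
  with assms show False
    by simp
qed

theorem lemma5p5:
  fixes X :: "'a::metric_space set" and T :: "'a \<Rightarrow> 'a"
  assumes "transitive_system X T"
  shows "L_m X T = L_m_limsup X T"
proof -
  have separation_iff: "(\<exists>x y. (\<forall>i\<in>{1..k}. x i \<in> U i \<and> y i \<in> U i) \<and> (\<exists>n. min_dist T k x y n > \<delta>)) \<longleftrightarrow>
      (\<exists>x y. (\<forall>i\<in>{1..k}. x i \<in> U i \<and> y i \<in> U i) \<and>
             limsup (\<lambda>n. ereal (min_dist T k x y n)) > ereal \<delta>)" (is "?once \<longleftrightarrow> ?limsup")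
    if "k \<ge> 1" "\<forall>i\<in>{1..k}. opene X (U i)" for k \<delta> and U :: "nat \<Rightarrow> 'a set"
  proof
    assume ?once
    then show ?limsup
      by (elim exE conjE) (rule transitive_system_limsup_separation[OF assms that])
  next
    assume ?limsup
    then obtain x y where "\<forall>i\<in>{1..k}. x i \<in> U i \<and> y i \<in> U i"
        and "limsup (\<lambda>n. ereal (min_dist T k x y n)) > ereal \<delta>"
      by (elim exE conjE)
    moreover from this(2) have "\<exists>n. min_dist T k x y n > \<delta>"
      by (rule limsup_gr_imp_ex_gr)
    ultimately show ?once
      by (intro exI[of _ x] exI[of _ y] conjI)
  qed
  show ?thesis
    unfolding L_m_def L_m_limsup_def
    by (simp only: separation_iff cong: imp_cong)
qed

end
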